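(* Let $F:\mathbb{R}^n\rightrightarrows\mathbb{R}^n$ be a set-valued mapping and let $(\bar x,0)\in\mathrm{gph}\,F$. Assume that $F$ is SCD semismooth$^{*}$ at $(\bar x,0)$ and SCD regular around $(\bar x,0)$. Then for every $\eta>0$ there is a neighborhood $U$ of $\bar x$ such that for every starting point $x^{(0)}\in U$ the SCD semismooth$^*$ Newton-type method (described in the context, with this $\eta$ and $\bar x$) is well defined and either stops after finitely many iterations at a solution of $0\in F(x)$ or produces a sequence $x^{(k)}$ that converges superlinearly to $\bar x$, for any choice of $(\hat x^{(k)},\hat y^{(k)})\in\mathrm{gph}\,F$ satisfying $\|(\hat x^{(k)},\hat y^{(k)})-(\bar x,0)\|\le\eta\|x^{(k)}-\bar x\|$ and any $L^{(k)}\in\mathcal{S}^*F(\hat x^{(k)},\hat y^{(k)})$ in Step 4.a) and any $L^{(k)}\in\mathcal{S}F(\hat x^{(k)},\hat y^{(k)})$ in Step 4.b).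
   Context: Notation. $\mathrm{gph}\,F=\{(x,y): y\in F(x)\}$. For a set $A$ and $\bar a\in A$, the tangent (contingent) cone $T_A(\bar a)$ is the set of all $u$ for which there are $t_k\downarrow0$, $u_k\to u$ with $\bar a+t_ku_k\in A$. $\mathcal{Z}_n$ is the metric space of all $n$-dimensional subspaces of $\mathbb{R}^{2n}$ with metric $d_{\mathcal{Z}_n}(L_1,L_2)=\|P_{L_1}-P_{L_2}\|$, $P_{L}$ being the orthogonal projection onto $L$. For $L\in\mathcal{Z}_n$ put $L^*:=\{(-v^*,u^* ): (u^*,v^* )\in L^\perp\}\in\mathcal{Z}_n$. For $n\times n$ matrices $A,B$, $\mathrm{rge}(A,B):=\{(Au,Bu): u\in\mathbb{R}^n\}$. $\mathcal{O}_F$ is the set of all $(x,y)\in\mathrm{gph}\,F$ with $T_{\mathrm{gph}\,F}(x,y)\in\mathcal{Z}_n$. For $(x,y)\in\mathrm{gph}\,F$, $\mathcal{S}F(x,y)$ is the set of all $L\in\mathcal{Z}_n$ for which there exist $(x_k,y_k)\in\mathcal{O}_F$, $(x_k,y_k)\to(x,y)$, with $d_{\mathcal{Z}_n}(L,T_{\mathrm{gph}\,F}(x_k,y_k))\to0$; and $\mathcal{S}^*F(x,y)$ is the set of all $L\in\mathcal{Z}_n$ for which there exist $(x_k,y_k)\in\mathcal{O}_F$, $(x_k,y_k)\to(x,y)$, with $d_{\mathcal{Z}_n}(L,T_{\mathrm{gph}\,F}(x_k,y_k)^* )\to0$. $F$ has the SCD property at $(x,y)\in\mathrm{gph}\,F$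 if $\mathcal{S}^*F(x,y)\ne\emptyset$, and around $(x,y)$ if it has the SCD property at all points of $\mathrm{gph}\,F$ in some neighborhood of $(x,y)$. $F$ is SCD semismooth$^*$ at $(\bar x,\bar y)\in\mathrm{gph}\,F$ if it has the SCD property around $(\bar x,\bar y)$ and for every $\epsilon>0$ there is $\delta>0$ such that $|\langle x^*,x-\bar x\rangle-\langle y^*,y-\bar y\rangle|\le\epsilon\|(x,y)-(\bar x,\bar y)\|\,\|(x^*,y^* )\|$ for all $(x,y)\in\mathrm{gph}\,F$ with $\|(x,y)-(\bar x,\bar y)\|\le\delta$ and all $(y^*,x^* )$ belonging to any $L\in\mathcal{S}^*F(x,y)$. $\mathcal{Z}_n^{\rm reg}$ is the set of all $L\in\mathcal{Z}_n$ such that $(y^*,0)\in L\Rightarrow y^*=0$. $F$ is SCD regular around $(x,y)\in\mathrm{gph}\,F$ if $F$ has the SCD property around $(x,y)$ and $\mathcal{S}^*F(x,y)\subseteq\mathcal{Z}_n^{\rm reg}$. The SCD semismooth$^*$ Newton-type method (for given $\eta>0$ and $\bar x$): 1. Choose a starting point $x^{(0)}$ and set $k:=0$. 2. If $0\in F(x^{(k)})$, stop. 3. (Approximation step) Compute $(\hat x^{(k)},\hat y^{(k)})\in\mathrm{gph}\,F$ satisfying $\|(\hat x^{(k)},\hat y^{(k)})-(\bar x,0)\|\le\eta\|x^{(k)}-\bar x\|$ and such that $\mathcal{S}^*F(\hat x^{(k)},\hat y^{(k)})\cap\mathcal{Z}_n^{\rm reg}\neq\emptyset$. 4. (Newton step)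 Compute the Newton direction $\Delta x^{(k)}$ by one of the following two alternatives. a) Select $n\times n$ matrices $A^{(k)},B^{(k)}$ with $L^{(k)}:=\mathrm{rge}({B^{(k)}}^T,{A^{(k)}}^T)\in\mathcal{S}^*F(\hat x^{(k)},\hat y^{(k)})\cap\mathcal{Z}_n^{\rm reg}$ and let $\Delta x^{(k)}$ be a solution of the linear system $A^{(k)}\Delta x=-B^{(k)}\hat y^{(k)}$. b) Select $n\times n$ matrices $A^{(k)},B^{(k)}$ with $L^{(k)}:=\mathrm{rge}(A^{(k)},B^{(k)})\in\mathcal{S}F(\hat x^{(k)},\hat y^{(k)})\cap\mathcal{Z}_n^{\rm reg}$, compute a solution $p$ of $B^{(k)}p=-\hat y^{(k)}$ and set $\Delta x^{(k)}=A^{(k)}p$. Then set $x^{(k+1)}=\hat x^{(k)}+\Delta x^{(k)}$. 5. Set $k:=k+1$ and go to 2. *)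

theory Defs
  imports "HOL-Analysis.Analysis" "HOL-Library.Landau_Symbols"
begin

text \<open>
  A set-valued mapping from \<open>R^n\<close> to \<open>R^n\<close> is a function \<open>real ^ 'n \<Rightarrow> (real ^ 'n) set\<close>. The space
  \<open>R^(2n)\<close> is the product type \<open>(real ^ 'n) \<times> (real ^ 'n)\<close>, whose library norm and inner product
  are the Euclidean ones.
\<close>

definition gph :: "('a \<Rightarrow> 'b set) \<Rightarrow> ('a \<times> 'b) set" where
  "gph F = {(x, y). y \<in> F x}"

definition tangent_cone :: "'a::real_normed_vector set \<Rightarrow> 'a \<Rightarrow> 'a set" where
  "tangent_cone A a = {u. \<exists>(t :: nat \<Rightarrow> real) (w :: nat \<Rightarrow> 'a).
     (\<forall>k. t k > 0) \<and> t \<longlonglongrightarrow> 0 \<and> w \<longlonglongrightarrow> u \<and> (\<forall>k. a + t k *\<^sub>R w k \<in> A)}"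


subsection \<open>The metric space of n-dimensional subspaces\<close>

definition Zn :: "((real ^ 'n) \<times> (real ^ 'n)) set set" where
  "Zn = {L. subspace L \<and> dim L = CARD('n)}"

definition orth_proj :: "'a::euclidean_space set \<Rightarrow> 'a \<Rightarrow> 'a" where
  "orth_proj L z = (THE p. p \<in> L \<and> z - p \<in> L\<^sup>\<bottom>)"

definition dZ :: "'a::euclidean_space set \<Rightarrow> 'a set \<Rightarrow> real" where
  "dZ L1 L2 = onorm (\<lambda>z. orth_proj L1 z - orth_proj L2 z)"

definition adj :: "((real ^ 'n) \<times> (real ^ 'n)) set \<Rightarrow> ((real ^ 'n) \<times> (real ^ 'n)) set" where
  "adj L = {(- vs, us) | us vs. (us, vs) \<in> L\<^sup>\<bottom>}"

definition rge :: "real ^ 'n ^ 'n \<Rightarrow> real ^ 'n ^ 'n \<Rightarrow> ((real ^ 'n) \<times> (real ^ 'n)) set" where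
  "rge A B = {(A *v u, B *v u) | u. True}"

definition Zreg :: "((real ^ 'n) \<times> (real ^ 'n)) set set" where
  "Zreg = {L \<in> Zn. \<forall>ys. (ys, 0) \<in> L \<longrightarrow> ys = 0}"


subsection \<open>SCD mappings\<close>

definition OF_set :: "(real ^ 'n \<Rightarrow> (real ^ 'n) set) \<Rightarrow> ((real ^ 'n) \<times> (real ^ 'n)) set" where
  "OF_set F = {p \<in> gph F. tangent_cone (gph F) p \<in> Zn}"

definition SF :: "(real ^ 'n \<Rightarrow> (real ^ 'n) set) \<Rightarrow> (real ^ 'n) \<times> (real ^ 'n)
    \<Rightarrow> ((real ^ 'n) \<times> (real ^ 'n)) set set" where
  "SF F p = {L \<in> Zn. \<exists>q :: nat \<Rightarrow> (real ^ 'n) \<times> (real ^ 'n).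
     (\<forall>k. q k \<in> OF_set F) \<and> q \<longlonglongrightarrow> p \<and>
     (\<lambda>k. dZ L (tangent_cone (gph F) (q k))) \<longlonglongrightarrow> 0}"

definition SstarF :: "(real ^ 'n \<Rightarrow> (real ^ 'n) set) \<Rightarrow> (real ^ 'n) \<times> (real ^ 'n)
    \<Rightarrow> ((real ^ 'n) \<times> (real ^ 'n)) set set" where
  "SstarF F p = {L \<in> Zn. \<exists>q :: nat \<Rightarrow> (real ^ 'n) \<times> (real ^ 'n).
     (\<forall>k. q k \<in> OF_set F) \<and> q \<longlonglongrightarrow> p \<and>
     (\<lambda>k. dZ L (adj (tangent_cone (gph F) (q k)))) \<longlonglongrightarrow> 0}"

definition SCD_at :: "(real ^ 'n \<Rightarrow> (real ^ 'n) set) \<Rightarrow> (real ^ 'n) \<times> (real ^ 'n) \<Rightarrow> bool" where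
  "SCD_at F p \<longleftrightarrow> p \<in> gph F \<and> SstarF F p \<noteq> {}"

definition SCD_around :: "(real ^ 'n \<Rightarrow> (real ^ 'n) set) \<Rightarrow> (real ^ 'n) \<times> (real ^ 'n) \<Rightarrow> bool" where
  "SCD_around F p \<longleftrightarrow> p \<in> gph F \<and> (\<exists>W. open W \<and> p \<in> W \<and> (\<forall>q \<in> gph F \<inter> W. SCD_at F q))"

definition SCD_semismooth_star ::
    "(real ^ 'n \<Rightarrow> (real ^ 'n) set) \<Rightarrow> real ^ 'n \<Rightarrow> real ^ 'n \<Rightarrow> bool" where
  "SCD_semismooth_star F xb yb \<longleftrightarrow> (xb, yb) \<in> gph F \<and> SCD_around F (xb, yb) \<and>
     (\<forall>\<epsilon>>0. \<exists>\<delta>>0. \<forall>x y. (x, y) \<in> gph F \<and> norm ((x, y) - (xb, yb)) \<le> \<delta> \<longrightarrow>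
        (\<forall>L \<in> SstarF F (x, y). \<forall>ys xs. (ys, xs) \<in> L \<longrightarrow>
           \<bar>inner xs (x - xb) - inner ys (y - yb)\<bar>
             \<le> \<epsilon> * norm ((x, y) - (xb, yb)) * norm (xs, ys)))"

definition SCD_regular_around ::
    "(real ^ 'n \<Rightarrow> (real ^ 'n) set) \<Rightarrow> real ^ 'n \<Rightarrow> real ^ 'n \<Rightarrow> bool" where
  "SCD_regular_around F x y \<longleftrightarrow> SCD_around F (x, y) \<and> SstarF F (x, y) \<subseteq> Zreg"


subsection \<open>The Newton-type method\<close>

definition approx_bound :: "(real ^ 'n \<Rightarrow> (real ^ 'n) set) \<Rightarrow> real \<Rightarrow> real ^ 'n \<Rightarrow> real ^ 'n
    \<Rightarrow> real ^ 'n \<Rightarrow> real ^ 'n \<Rightarrow> bool" where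
  "approx_bound F \<eta> xb x xh yh \<longleftrightarrow>
     (xh, yh) \<in> gph F \<and> norm ((xh, yh) - (xb, 0)) \<le> \<eta> * norm (x - xb)"

definition approx_step :: "(real ^ 'n \<Rightarrow> (real ^ 'n) set) \<Rightarrow> real \<Rightarrow> real ^ 'n \<Rightarrow> real ^ 'n
    \<Rightarrow> real ^ 'n \<Rightarrow> real ^ 'n \<Rightarrow> bool" where
  "approx_step F \<eta> xb x xh yh \<longleftrightarrow>
     approx_bound F \<eta> xb x xh yh \<and> SstarF F (xh, yh) \<inter> Zreg \<noteq> {}"

text \<open>\<open>newton_dir_a L yh d\<close> and \<open>newton_dir_b L yh d\<close>: the vector \<open>d\<close> is a possible Newton
  direction for the subspace \<open>L\<close> in alternative a) and b), respectively.\<close>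

definition newton_dir_a :: "((real ^ 'n) \<times> (real ^ 'n)) set \<Rightarrow> real ^ 'n \<Rightarrow> real ^ 'n \<Rightarrow> bool" where
  "newton_dir_a L yh d \<longleftrightarrow>
     (\<exists>A B. L = rge (transpose B) (transpose A) \<and> A *v d = - (B *v yh))"

definition newton_dir_b :: "((real ^ 'n) \<times> (real ^ 'n)) set \<Rightarrow> real ^ 'n \<Rightarrow> real ^ 'n \<Rightarrow> bool" where
  "newton_dir_b L yh d \<longleftrightarrow>
     (\<exists>A B p. L = rge A B \<and> B *v p = - yh \<and> d = A *v p)"

definition newton_step :: "(real ^ 'n \<Rightarrow> (real ^ 'n) set) \<Rightarrow> real \<Rightarrow> real ^ 'n
    \<Rightarrow> real ^ 'n \<Rightarrow> real ^ 'n \<Rightarrow> bool" where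
  "newton_step F \<eta> xb x x' \<longleftrightarrow>
     (\<exists>xh yh L d. approx_step F \<eta> xb x xh yh \<and>
        (L \<in> SstarF F (xh, yh) \<inter> Zreg \<and> newton_dir_a L yh d \<or>
         L \<in> SF F (xh, yh) \<inter> Zreg \<and> newton_dir_b L yh d) \<and>
        x' = xh + d)"

text \<open>The convergence theorem allows every \<open>(xh, yh)\<close> in the graph that satisfies the norm bound,
  and every subspace in \<open>SstarF F (xh, yh)\<close> or \<open>SF F (xh, yh)\<close>; that these choices always meet the
  regularity requirements of the method is part of its conclusion
  (\<open>choices_admissible\<close>).\<close>

definition newton_step_any :: "(real ^ 'n \<Rightarrow> (real ^ 'n) set) \<Rightarrow> real \<Rightarrow> real ^ 'n
    \<Rightarrow> real ^ 'n \<Rightarrow> real ^ 'n \<Rightarrow> bool" where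
  "newton_step_any F \<eta> xb x x' \<longleftrightarrow>
     (\<exists>xh yh L d. approx_bound F \<eta> xb x xh yh \<and>
        (L \<in> SstarF F (xh, yh) \<and> newton_dir_a L yh d \<or>
         L \<in> SF F (xh, yh) \<and> newton_dir_b L yh d) \<and>
        x' = xh + d)"

definition choices_admissible :: "(real ^ 'n \<Rightarrow> (real ^ 'n) set) \<Rightarrow> real \<Rightarrow> real ^ 'n
    \<Rightarrow> real ^ 'n \<Rightarrow> bool" where
  "choices_admissible F \<eta> xb x \<longleftrightarrow>
     (\<forall>xh yh. approx_bound F \<eta> xb x xh yh \<longrightarrow>
        approx_step F \<eta> xb x xh yh \<and> SstarF F (xh, yh) \<subseteq> Zreg \<and> SF F (xh, yh) \<subseteq> Zreg)"

lemma newton_step_any_iff: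
  assumes "choices_admissible F \<eta> xb x"
  shows "newton_step_any F \<eta> xb x x' \<longleftrightarrow> newton_step F \<eta> xb x x'"
  using assms unfolding choices_admissible_def newton_step_any_def newton_step_def approx_step_def
  by blast

text \<open>All operations of one pass can be carried out at the iterate \<open>x\<close>, whatever choices are made:
  the approximation step has a solution, and in both alternatives there is an eligible subspace,
  every such subspace has a matrix representation, and the linear system belonging to any
  representation is solvable.\<close>

definition newton_executable :: "(real ^ 'n \<Rightarrow> (real ^ 'n) set) \<Rightarrow> real \<Rightarrow> real ^ 'n
    \<Rightarrow> real ^ 'n \<Rightarrow> bool" where
  "newton_executable F \<eta> xb x \<longleftrightarrow>
     (\<exists>xh yh. approx_step F \<eta> xb x xh yh) \<and>
     (\<forall>xh yh. approx_step F \<eta> xb x xh yh \<longrightarrow>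
        SstarF F (xh, yh) \<inter> Zreg \<noteq> {} \<and>
        (\<forall>L \<in> SstarF F (xh, yh) \<inter> Zreg.
           (\<exists>A B. L = rge (transpose B) (transpose A)) \<and>
           (\<forall>A B. L = rge (transpose B) (transpose A) \<longrightarrow> (\<exists>d. A *v d = - (B *v yh)))) \<and>
        SF F (xh, yh) \<inter> Zreg \<noteq> {} \<and>
        (\<forall>L \<in> SF F (xh, yh) \<inter> Zreg.
           (\<exists>A B. L = rge A B) \<and>
           (\<forall>A B. L = rge A B \<longrightarrow> (\<exists>p. B *v p = - yh))))"

text \<open>The points that can occur as iterates for the starting point \<open>x0\<close>.\<close>

inductive_set newton_iterates :: "(real ^ 'n \<Rightarrow> (real ^ 'n) set) \<Rightarrow> real \<Rightarrow> real ^ 'n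
    \<Rightarrow> real ^ 'n \<Rightarrow> (real ^ 'n) set"
  for F \<eta> xb x0 where
  start: "x0 \<in> newton_iterates F \<eta> xb x0"
| step: "x \<in> newton_iterates F \<eta> xb x0 \<Longrightarrow> 0 \<notin> F x \<Longrightarrow> newton_step_any F \<eta> xb x x'
    \<Longrightarrow> x' \<in> newton_iterates F \<eta> xb x0"

definition newton_well_defined :: "(real ^ 'n \<Rightarrow> (real ^ 'n) set) \<Rightarrow> real \<Rightarrow> real ^ 'n
    \<Rightarrow> real ^ 'n \<Rightarrow> bool" where
  "newton_well_defined F \<eta> xb x0 \<longleftrightarrow>
     (\<forall>x \<in> newton_iterates F \<eta> xb x0. 0 \<notin> F x \<longrightarrow>
        newton_executable F \<eta> xb x \<and> choices_admissible F \<eta> xb x)"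

text \<open>A run is encoded as an infinite sequence which is constrained only as long as the stopping
  test has not succeeded; after a stop its values carry no information.\<close>

definition newton_run :: "(real ^ 'n \<Rightarrow> (real ^ 'n) set) \<Rightarrow> real \<Rightarrow> real ^ 'n
    \<Rightarrow> (nat \<Rightarrow> real ^ 'n) \<Rightarrow> bool" where
  "newton_run F \<eta> xb x \<longleftrightarrow>
     (\<forall>k. (\<forall>i\<le>k. 0 \<notin> F (x i)) \<longrightarrow> newton_step_any F \<eta> xb (x k) (x (Suc k)))"

definition stops_at :: "(real ^ 'n \<Rightarrow> (real ^ 'n) set) \<Rightarrow> (nat \<Rightarrow> real ^ 'n) \<Rightarrow> nat \<Rightarrow> bool" where
  "stops_at F x k \<longleftrightarrow> (\<forall>i<k. 0 \<notin> F (x i)) \<and> 0 \<in> F (x k)"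

definition superlinear_convergence :: "(nat \<Rightarrow> 'a::real_normed_vector) \<Rightarrow> 'a \<Rightarrow> bool" where
  "superlinear_convergence x l \<longleftrightarrow>
     x \<longlonglongrightarrow> l \<and> (\<lambda>k. norm (x (Suc k) - l)) \<in> o(\<lambda>k. norm (x k - l))"

end

theory Submission
  imports Defs
begin

text \<open>
  Passing to the adjoint is an isometric involution that exchanges \<open>SF\<close> and \<open>SstarF\<close> and preserves
  regularity, so both alternatives of the Newton step reduce to one: for some \<open>L \<in> SstarF F (xh, yh)\<close>
  the direction \<open>d\<close> satisfies \<open>xs \<bullet> d = - (ys \<bullet> yh)\<close> on \<open>L\<close>. The semismoothness inequality then
  bounds \<open>xs \<bullet> (xh + d - xb)\<close>, and regularity provides \<open>(ys, xs) \<in> L\<close> with \<open>xs = xh + d - xb\<close>. The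
  estimate is uniform because the Grassmannian is compact: regularity at \<open>(xb, 0)\<close> yields a bound
  \<open>norm ys \<le> \<kappa> * norm xs\<close> on all subspaces in \<open>SstarF F q\<close> for \<open>q\<close> near \<open>(xb, 0)\<close>. Compactness is
  obtained by representing subspaces by orthonormal frames.
\<close>

section \<open>Orthogonal projections\<close>

text \<open>Two candidates differ by a vector lying both in \<open>L\<close> and in its orthogonal
  complement, hence orthogonal to itself. All projections below are identified through this
  rule.\<close>

lemma orth_proj_eqI:
  assumes "subspace L" "p \<in> L" "z - p \<in> L\<^sup>\<bottom>"
  shows "orth_proj L z = p"
  unfolding orth_proj_def
proof (rule the_equality)
  fix q assume q: "q \<in> L \<and> z - q \<in> L\<^sup>\<bottom>"
  have "p - q \<in> L" using assms q by (simp add: subspace_diff)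
  moreover have "(z - q) - (z - p) \<in> L\<^sup>\<bottom>"
    using assms q subspace_orthogonal_comp subspace_diff by blast
  ultimately have "p - q \<in> L \<inter> L\<^sup>\<bottom>" by simp
  then have "orthogonal (p - q) (p - q)" unfolding orthogonal_comp_def by blast
  then show "q = p" by (simp add: orthogonal_self)
qed (use assms in simp)

lemma
  assumes "subspace L"
  shows orth_proj_in: "orth_proj L z \<in> L"
    and orth_proj_compl: "z - orth_proj L z \<in> L\<^sup>\<bottom>"
proof -
  obtain p w where "p \<in> L" "w \<in> L\<^sup>\<bottom>" "z = p + w"
    using subspace_sum_orthogonal_comp[OF assms] by (metis UNIV_I set_plus_elim)
  then have "orth_proj L z = p" using assms by (intro orth_proj_eqI) auto
  then show "orth_proj L z \<in> L" "z - orth_proj L z \<in> L\<^sup>\<bottom>"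
    using \<open>p \<in> L\<close> \<open>w \<in> L\<^sup>\<bottom>\<close> \<open>z = p + w\<close> by auto
qed

lemma orth_proj_self:
  assumes "subspace L" "z \<in> L"
  shows "orth_proj L z = z"
  using assms by (intro orth_proj_eqI) (auto simp: subspace_0 subspace_orthogonal_comp)

lemma linear_orth_proj:
  assumes "subspace L"
  shows "linear (orth_proj L)"
proof
  fix x y and c :: real
  show "orth_proj L (x + y) = orth_proj L x + orth_proj L y"
  proof (rule orth_proj_eqI[OF assms])
    have "(x - orth_proj L x) + (y - orth_proj L y) \<in> L\<^sup>\<bottom>"
      by (intro subspace_add subspace_orthogonal_comp orth_proj_compl assms)
    then show "x + y - (orth_proj L x + orth_proj L y) \<in> L\<^sup>\<bottom>" by (simp add: algebra_simps)
  qed (intro subspace_add orth_proj_in assms)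
  show "orth_proj L (c *\<^sub>R x) = c *\<^sub>R orth_proj L x"
  proof (rule orth_proj_eqI[OF assms])
    have "c *\<^sub>R (x - orth_proj L x) \<in> L\<^sup>\<bottom>"
      by (intro subspace_scale subspace_orthogonal_comp orth_proj_compl assms)
    then show "c *\<^sub>R x - c *\<^sub>R orth_proj L x \<in> L\<^sup>\<bottom>" by (simp add: algebra_simps)
  qed (intro subspace_scale orth_proj_in assms)
qed

lemma norm_orth_proj_diff_le:
  assumes "subspace L" "subspace M"
  shows "norm (orth_proj L z - orth_proj M z) \<le> dZ L M * norm z"
  unfolding dZ_def
proof (rule onorm)
  show "bounded_linear (\<lambda>z. orth_proj L z - orth_proj M z)"
    using linear_orth_proj[OF assms(1)] linear_orth_proj[OF assms(2)]
    by (simp add: linear_compose_sub linear_conv_bounded_linear[symmetric])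
qed

lemma dZ_nonneg:
  assumes "subspace L" "subspace M"
  shows "0 \<le> dZ L M"
  unfolding dZ_def
  using linear_orth_proj[OF assms(1)] linear_orth_proj[OF assms(2)]
  by (intro onorm_pos_le) (simp add: linear_compose_sub linear_conv_bounded_linear[symmetric])


section \<open>Orthonormal frames and compactness\<close>

text \<open>Encoding a frame as a vector over the finite type \<open>'m\<close> puts all frames into
  one Euclidean space, where compactness means closed and bounded.\<close>

definition orthonormal_frame :: "'a::euclidean_space ^ 'm \<Rightarrow> bool" where
  "orthonormal_frame b \<longleftrightarrow> (\<forall>i j. b $ i \<bullet> b $ j = (if i = j then 1 else 0))"

definition frame_span :: "'a::euclidean_space ^ 'm \<Rightarrow> 'a set" where
  "frame_span b = span (range (($) b))"

text \<open>For an orthonormal frame this is the orthogonal projection onto its span; as an explicit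
  formula it is jointly continuous in \<open>b\<close> and \<open>z\<close>.\<close>

definition frame_proj :: "'a::euclidean_space ^ 'm \<Rightarrow> 'a \<Rightarrow> 'a" where
  "frame_proj b z = (\<Sum>i\<in>UNIV. (z \<bullet> b $ i) *\<^sub>R b $ i)"

lemma subspace_frame_span: "subspace (frame_span b)"
  by (simp add: frame_span_def)

lemma frame_span_eq: "frame_span b = range (\<lambda>u::real^'m. \<Sum>i\<in>UNIV. u $ i *\<^sub>R b $ i)"
  for b :: "'a::euclidean_space ^ 'm"
proof
  have "subspace (range (\<lambda>u::real^'m. \<Sum>i\<in>UNIV. u $ i *\<^sub>R b $ i))"
    by (intro linear_subspace_image subspace_UNIV linear_compose_sum)
       (auto intro!: linearI simp: algebra_simps)
  moreover have "b $ i \<in> range (\<lambda>u::real^'m. \<Sum>i\<in>UNIV. u $ i *\<^sub>R b $ i)" for i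
    by (rule range_eqI[of _ _ "axis i 1"]) (simp add: axis_def if_distrib[of "\<lambda>c. c *\<^sub>R _"] cong: if_cong)
  ultimately show "frame_span b \<subseteq> range (\<lambda>u::real^'m. \<Sum>i\<in>UNIV. u $ i *\<^sub>R b $ i)"
    unfolding frame_span_def by (intro span_minimal) auto
  show "range (\<lambda>u::real^'m. \<Sum>i\<in>UNIV. u $ i *\<^sub>R b $ i) \<subseteq> frame_span b"
    unfolding frame_span_def by (intro image_subsetI span_sum span_scale span_base) auto
qed

text \<open>Keeps limits of frames from losing dimension: orthonormality passes to the limit and
  forces independence.\<close>

lemma dim_frame_span:
  fixes b :: "'a::euclidean_space ^ 'm"
  assumes "orthonormal_frame b"
  shows "dim (frame_span b) = CARD('m)"
proof -
  have inj: "inj (($) b)"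
    using assms unfolding orthonormal_frame_def inj_def by (metis zero_neq_one)
  have "pairwise orthogonal (range (($) b))"
    using assms unfolding orthonormal_frame_def pairwise_def orthogonal_def by auto
  moreover have "0 \<notin> range (($) b)"
    using assms unfolding orthonormal_frame_def by (metis imageE inner_zero_left zero_neq_one)
  ultimately have "independent (range (($) b))" by (rule pairwise_orthogonal_independent)
  then show ?thesis
    unfolding frame_span_def by (simp add: dim_eq_card_independent card_image[OF inj])
qed

lemma orth_proj_frame_span:
  fixes b :: "'a::euclidean_space ^ 'm"
  assumes "orthonormal_frame b"
  shows "orth_proj (frame_span b) z = frame_proj b z"
proof (rule orth_proj_eqI[OF subspace_frame_span])
  show "frame_proj b z \<in> frame_span b"
    unfolding frame_proj_def frame_span_def by (intro span_sum span_scale span_base) auto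
  have "b $ j \<bullet> (z - frame_proj b z) = 0" for j
    using assms unfolding orthonormal_frame_def frame_proj_def
    by (simp add: inner_diff_right inner_sum_right inner_commute
        if_distrib[of "\<lambda>c. _ * c"] cong: if_cong)
  then show "z - frame_proj b z \<in> (frame_span b)\<^sup>\<bottom>"
    unfolding frame_span_eq orthogonal_comp_def orthogonal_def by (auto simp: inner_sum_left)
qed

lemma orthonormal_frame_exists:
  fixes L :: "'a::euclidean_space set"
  assumes "subspace L" "dim L = CARD('m)"
  obtains b :: "'a ^ 'm" where "orthonormal_frame b" "frame_span b = L"
proof -
  obtain B where B: "B \<subseteq> L" "pairwise orthogonal B" "\<And>x. x \<in> B \<Longrightarrow> norm x = 1"
    "independent B" "card B = dim L" "span B = L"
    using orthonormal_basis_subspace[OF assms(1)] by metis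
  have "finite B" using B(4) independent_imp_finite by blast
  then obtain f where f: "bij_betw f (UNIV :: 'm set) B"
    using B(5) assms(2) by (metis finite_class.finite_UNIV finite_same_card_bij)
  define b :: "'a ^ 'm" where "b = (\<chi> i. f i)"
  have eq: "b $ i = f i" for i by (simp add: b_def)
  show ?thesis
  proof
    have "f i \<bullet> f j = (if i = j then 1 else 0)" for i j
    proof (cases "i = j")
      case True
      then show ?thesis using B(3) f by (auto simp: bij_betw_def dot_square_norm)
    next
      case False
      then have "f i \<noteq> f j" "f i \<in> B" "f j \<in> B" using f by (auto simp: bij_betw_def inj_def)
      then show ?thesis using B(2) False by (auto simp: pairwise_def orthogonal_def)
    qed
    then show "orthonormal_frame b" by (simp add: orthonormal_frame_def eq)
    have "range (($) b) = B" using f by (auto simp: eq bij_betw_def)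
    then show "frame_span b = L" using B(6) by (simp add: frame_span_def)
  qed
qed

text \<open>Unit entries bound the frame, and orthonormality is a finite system of equations between
  continuous functions, hence closed.\<close>

lemma compact_orthonormal_frames: "compact {b :: 'a::euclidean_space ^ 'm. orthonormal_frame b}"
proof (unfold compact_eq_bounded_closed, intro conjI)
  have "norm b \<le> CARD('m)" if "orthonormal_frame b" for b :: "'a ^ 'm"
  proof -
    have "norm (b $ i) = 1" for i
      using that by (simp add: orthonormal_frame_def norm_eq_1)
    then show ?thesis unfolding norm_vec_def using L2_set_le_sum[of UNIV "\<lambda>i. norm (b $ i)"] by simp
  qed
  then show "bounded {b :: 'a ^ 'm. orthonormal_frame b}" unfolding bounded_iff by blast
  show "closed {b :: 'a ^ 'm. orthonormal_frame b}"
    unfolding orthonormal_frame_def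
    by (intro closed_Collect_all closed_Collect_eq continuous_intros)
qed

lemma tendsto_frame_proj:
  fixes b :: "nat \<Rightarrow> 'a::euclidean_space ^ 'm"
  assumes "b \<longlonglongrightarrow> c" "z \<longlonglongrightarrow> w"
  shows "(\<lambda>k. frame_proj (b k) (z k)) \<longlonglongrightarrow> frame_proj c w"
  unfolding frame_proj_def by (intro tendsto_intros assms)

text \<open>A Lipschitz estimate in the frame, linear in \<open>norm z\<close>, so that
  \<open>onorm_le\<close> turns it into a bound on \<open>dZ\<close>.\<close>

lemma norm_frame_proj_diff_le:
  fixes b c :: "'a::euclidean_space ^ 'm"
  assumes "orthonormal_frame b" "orthonormal_frame c"
  shows "norm (frame_proj b z - frame_proj c z) \<le> (2 * (\<Sum>i\<in>UNIV. norm (b $ i - c $ i))) * norm z"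
proof -
  have 1: "norm (b $ i) = 1" "norm (c $ i) = 1" for i
    using assms by (simp_all add: orthonormal_frame_def norm_eq_1)
  have "norm ((z \<bullet> b $ i) *\<^sub>R b $ i - (z \<bullet> c $ i) *\<^sub>R c $ i) \<le> 2 * norm z * norm (b $ i - c $ i)" for i
  proof -
    \<comment> \<open>The frame vector is exchanged in one factor at a time; each exchange costs
      \<open>norm z * norm (b $ i - c $ i)\<close>, whence the factor 2.\<close>
    have "(z \<bullet> b $ i) *\<^sub>R b $ i - (z \<bullet> c $ i) *\<^sub>R c $ i
        = (z \<bullet> (b $ i - c $ i)) *\<^sub>R b $ i + (z \<bullet> c $ i) *\<^sub>R (b $ i - c $ i)"
      by (simp add: algebra_simps)
    then have "norm ((z \<bullet> b $ i) *\<^sub>R b $ i - (z \<bullet> c $ i) *\<^sub>R c $ i)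
        \<le> \<bar>z \<bullet> (b $ i - c $ i)\<bar> + \<bar>z \<bullet> c $ i\<bar> * norm (b $ i - c $ i)"
      using norm_triangle_ineq[of "(z \<bullet> (b $ i - c $ i)) *\<^sub>R b $ i" "(z \<bullet> c $ i) *\<^sub>R (b $ i - c $ i)"]
      by (simp add: 1)
    also have "\<dots> \<le> norm z * norm (b $ i - c $ i) + norm z * norm (b $ i - c $ i)"
      using Cauchy_Schwarz_ineq2[of z "b $ i - c $ i"] Cauchy_Schwarz_ineq2[of z "c $ i"]
      by (intro add_mono mult_right_mono) (simp_all add: 1)
    finally show ?thesis by simp
  qed
  then have "norm (\<Sum>i\<in>UNIV. (z \<bullet> b $ i) *\<^sub>R b $ i - (z \<bullet> c $ i) *\<^sub>R c $ i)
      \<le> (\<Sum>i\<in>UNIV. 2 * norm z * norm (b $ i - c $ i))"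
    by (intro sum_norm_le) auto
  then show ?thesis
    unfolding frame_proj_def by (simp add: sum_subtractf sum_distrib_left algebra_simps)
qed

lemma dZ_frame_span_tendsto:
  fixes b :: "nat \<Rightarrow> 'a::{euclidean_space, perfect_space} ^ 'm"
  assumes "\<And>k. orthonormal_frame (b k)" "orthonormal_frame c" "b \<longlonglongrightarrow> c"
  shows "(\<lambda>k. dZ (frame_span c) (frame_span (b k))) \<longlonglongrightarrow> 0"
proof (rule tendsto_sandwich[OF _ _ tendsto_const])
  show "\<forall>\<^sub>F k in sequentially. 0 \<le> dZ (frame_span c) (frame_span (b k))"
    by (simp add: dZ_nonneg subspace_frame_span)
  show "\<forall>\<^sub>F k in sequentially. dZ (frame_span c) (frame_span (b k))
      \<le> 2 * (\<Sum>i\<in>UNIV. norm (c $ i - b k $ i))"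
    unfolding dZ_def orth_proj_frame_span[OF assms(1)] orth_proj_frame_span[OF assms(2)]
    by (intro always_eventually allI onorm_le norm_frame_proj_diff_le assms)
  have "(\<lambda>k. 2 * (\<Sum>i\<in>UNIV. norm (c $ i - b k $ i))) \<longlonglongrightarrow> 2 * (\<Sum>i\<in>UNIV. norm (c $ i - c $ i))"
    by (intro tendsto_intros assms)
  then show "(\<lambda>k. 2 * (\<Sum>i\<in>UNIV. norm (c $ i - b k $ i))) \<longlonglongrightarrow> 0" by simp
qed


section \<open>The adjoint subspace\<close>

lemma mem_adj: "(a, c) \<in> adj L \<longleftrightarrow> (c, - a) \<in> L\<^sup>\<bottom>"
  unfolding adj_def by (auto intro: exI[of _ "- a"])

text \<open>Exhibits \<open>adj L\<close> as the complement of \<open>L\<close> for the standard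
  symplectic form \<open>u \<bullet> c - v \<bullet> a\<close>.\<close>

lemma mem_adj_iff: "(a, c) \<in> adj L \<longleftrightarrow> (\<forall>u v. (u, v) \<in> L \<longrightarrow> u \<bullet> c = v \<bullet> a)"
  unfolding mem_adj orthogonal_comp_def orthogonal_def by auto

lemma adj_eq_image: "adj L = (\<lambda>(u, v). (- v, u)) ` (L\<^sup>\<bottom>)"
  unfolding adj_def by force

lemma linear_rotate: "linear (\<lambda>(u, v). (- v, u) :: 'a::real_vector \<times> 'a)"
  by (rule linearI) auto

lemma subspace_adj: "subspace (adj L)"
  unfolding adj_eq_image by (intro linear_subspace_image linear_rotate subspace_orthogonal_comp)

lemma adj_adj:
  assumes "subspace L"
  shows "adj (adj L) = L"
proof -
  have "(u, v) \<in> adj (adj L) \<longleftrightarrow> (u, v) \<in> (L\<^sup>\<bottom>)\<^sup>\<bottom>" for u v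
  proof -
    have "(u, v) \<in> adj (adj L) \<longleftrightarrow> (\<forall>a c. (c, - a) \<in> L\<^sup>\<bottom> \<longrightarrow> a \<bullet> v = c \<bullet> u)"
      unfolding mem_adj_iff[of u v "adj L"] mem_adj[of _ _ L] by blast
    \<comment> \<open>Substitution \<open>(x, y) = (c, - a)\<close>, which turns the symplectic
      pairing into the ordinary inner product.\<close>
    also have "\<dots> \<longleftrightarrow> (\<forall>x y. (x, y) \<in> L\<^sup>\<bottom> \<longrightarrow> (- y) \<bullet> v = x \<bullet> u)"
      by (metis minus_minus)
    also have "\<dots> \<longleftrightarrow> (\<forall>x y. (x, y) \<in> L\<^sup>\<bottom> \<longrightarrow> (x, y) \<bullet> (u, v) = 0)"
    proof -
      have "(- y) \<bullet> v = x \<bullet> u \<longleftrightarrow> (x, y) \<bullet> (u, v) = 0" for x y by auto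
      then show ?thesis by simp
    qed
    also have "\<dots> \<longleftrightarrow> (u, v) \<in> (L\<^sup>\<bottom>)\<^sup>\<bottom>"
      unfolding orthogonal_comp_def[of "L\<^sup>\<bottom>"] orthogonal_def
      by (simp only: mem_Collect_eq Ball_def split_paired_All)
    finally show ?thesis .
  qed
  then show ?thesis unfolding orthogonal_comp_self[OF assms] by auto
qed

lemma adj_Zn:
  assumes "L \<in> Zn"
  shows "adj L \<in> Zn"
proof -
  have L: "subspace L" "dim L = CARD('a)" using assms by (auto simp: Zn_def)
  have "dim (L\<^sup>\<bottom>) + dim L = DIM((real ^ 'a) \<times> (real ^ 'a))"
    using dim_subspace_orthogonal_to_vectors[OF L(1) subspace_UNIV]
    by (simp add: orthogonal_comp_def)
  then have "dim (L\<^sup>\<bottom>) = CARD('a)" using L by simp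
  moreover have "dim (adj L) = dim (L\<^sup>\<bottom>)"
    unfolding adj_eq_image by (intro dim_image_eq linear_rotate) (auto simp: inj_on_def)
  ultimately show ?thesis using subspace_adj by (auto simp: Zn_def)
qed

text \<open>\<open>adj L\<close> is the rotated orthogonal complement, so its projection is the
  identity minus that of \<open>L\<close>, conjugated by the rotation; \<open>(c, - a)\<close> is
  the preimage of \<open>(a, c)\<close> under it.\<close>

lemma orth_proj_adj:
  assumes "subspace L"
  shows "orth_proj (adj L) (a, c) = (\<lambda>(u, v). (- v, u)) ((c, - a) - orth_proj L (c, - a))"
proof (rule orth_proj_eqI[OF subspace_adj])
  show "(\<lambda>(u, v). (- v, u)) ((c, - a) - orth_proj L (c, - a)) \<in> adj L"
    unfolding adj_eq_image by (intro imageI orth_proj_compl assms)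
  obtain u v where uv: "orth_proj L (c, - a) = (u, v)" by fastforce
  then have "(u, v) \<in> L" using orth_proj_in[OF assms] by metis
  then show "(a, c) - (\<lambda>(u, v). (- v, u)) ((c, - a) - orth_proj L (c, - a)) \<in> (adj L)\<^sup>\<bottom>"
    by (auto simp: uv orthogonal_comp_def orthogonal_def mem_adj_iff inner_commute)
qed

text \<open>In the difference of the two projections the identity terms cancel, and the rotation
  preserves norms.\<close>

lemma dZ_adj_le:
  assumes "subspace L" "subspace M"
  shows "dZ (adj L) (adj M) \<le> dZ L M"
  unfolding dZ_def[of "adj L"]
proof (rule onorm_le)
  fix z :: "(real ^ 'a) \<times> (real ^ 'a)"
  obtain a c where z: "z = (a, c)" by fastforce
  obtain u v where uv: "orth_proj L (c, - a) = (u, v)" by fastforce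
  obtain u' v' where uv': "orth_proj M (c, - a) = (u', v')" by fastforce
  have "norm (orth_proj (adj L) z - orth_proj (adj M) z)
      = norm (orth_proj L (c, - a) - orth_proj M (c, - a))"
    by (simp add: z orth_proj_adj assms uv uv' norm_Pair norm_minus_commute)
  also have "\<dots> \<le> dZ L M * norm (c, - a)" by (rule norm_orth_proj_diff_le[OF assms])
  also have "norm (c, - a) = norm z" by (simp add: z norm_Pair)
  finally show "norm (orth_proj (adj L) z - orth_proj (adj M) z) \<le> dZ L M * norm z" .
qed

lemma Zn_subspace: "L \<in> Zn \<Longrightarrow> subspace L"
  by (simp add: Zn_def)

lemma tangent_cone_Zn: "q \<in> OF_set F \<Longrightarrow> tangent_cone (gph F) q \<in> Zn"
  by (simp add: OF_set_def)

lemma dZ_tendsto_0_le: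
  assumes "g \<longlonglongrightarrow> 0" "\<And>k. dZ (L k) (M k) \<le> g k" "\<And>k. subspace (L k)" "\<And>k. subspace (M k)"
  shows "(\<lambda>k. dZ (L k) (M k)) \<longlonglongrightarrow> 0"
  using assms by (intro tendsto_sandwich[OF _ _ tendsto_const assms(1)]) (auto simp: dZ_nonneg)

lemma adj_SF:
  assumes "L \<in> SF F p"
  shows "adj L \<in> SstarF F p"
proof -
  obtain q where L: "L \<in> Zn" and q: "\<And>k. q k \<in> OF_set F" "q \<longlonglongrightarrow> p"
    and lim: "(\<lambda>k. dZ L (tangent_cone (gph F) (q k))) \<longlonglongrightarrow> 0"
    using assms unfolding SF_def by auto
  have "(\<lambda>k. dZ (adj L) (adj (tangent_cone (gph F) (q k)))) \<longlonglongrightarrow> 0"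
    using q L by (intro dZ_tendsto_0_le[OF lim] dZ_adj_le)
      (auto intro: Zn_subspace tangent_cone_Zn subspace_adj)
  then show ?thesis using adj_Zn[OF L] q unfolding SstarF_def by auto
qed

lemma adj_SstarF:
  assumes "L \<in> SstarF F p"
  shows "adj L \<in> SF F p"
proof -
  obtain q where L: "L \<in> Zn" and q: "\<And>k. q k \<in> OF_set F" "q \<longlonglongrightarrow> p"
    and lim: "(\<lambda>k. dZ L (adj (tangent_cone (gph F) (q k)))) \<longlonglongrightarrow> 0"
    using assms unfolding SstarF_def by auto
  \<comment> \<open>The contraction property is applied to the adjoint tangent cone, whose own
    adjoint is the tangent cone again.\<close>
  have "dZ (adj L) (tangent_cone (gph F) (q k)) \<le> dZ L (adj (tangent_cone (gph F) (q k)))" for k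
    using dZ_adj_le[OF Zn_subspace[OF L] subspace_adj, of "tangent_cone (gph F) (q k)"] q(1)
    by (simp add: adj_adj Zn_subspace tangent_cone_Zn)
  then have "(\<lambda>k. dZ (adj L) (tangent_cone (gph F) (q k))) \<longlonglongrightarrow> 0"
    using q by (intro dZ_tendsto_0_le[OF lim]) (auto intro: Zn_subspace tangent_cone_Zn subspace_adj)
  then show ?thesis using adj_Zn[OF L] q unfolding SF_def by auto
qed


section \<open>Uniform regularity\<close>

lemma SstarF_Zn: "L \<in> SstarF F p \<Longrightarrow> L \<in> Zn"
  by (simp add: SstarF_def)

lemma SF_Zn: "L \<in> SF F p \<Longrightarrow> L \<in> Zn"
  by (simp add: SF_def)

lemma SstarF_approx:
  assumes "L \<in> SstarF F p" "\<epsilon> > 0"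
  obtains q where "q \<in> OF_set F" "dist q p < \<epsilon>" "dZ L (adj (tangent_cone (gph F) q)) < \<epsilon>"
proof -
  obtain q where q: "\<And>k. q k \<in> OF_set F" "q \<longlonglongrightarrow> p"
    "(\<lambda>k. dZ L (adj (tangent_cone (gph F) (q k)))) \<longlonglongrightarrow> 0"
    using assms unfolding SstarF_def by auto
  have "\<forall>\<^sub>F k in sequentially. dist (q k) p < \<epsilon> \<and> dZ L (adj (tangent_cone (gph F) (q k))) < \<epsilon>"
    using tendstoD[OF q(2) assms(2)] order_tendstoD(2)[OF q(3) assms(2)] by eventually_elim auto
  then obtain k where "dist (q k) p < \<epsilon>" "dZ L (adj (tangent_cone (gph F) (q k))) < \<epsilon>"
    using eventually_happens'[OF sequentially_bot] by blast
  then show ?thesis using that q(1) by blast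
qed

text \<open>If no pair of constants worked, normalized violating vectors and frames of nearby
  adjoint tangent spaces would subconverge. The limit would be a subspace in
  \<open>SstarF F p\<close> containing some \<open>(ys, 0)\<close> with \<open>norm ys = 1\<close>,
  against regularity.\<close>

lemma SstarF_norm_bound:
  fixes F :: "real ^ 'n \<Rightarrow> (real ^ 'n) set"
  assumes reg: "SstarF F p \<subseteq> Zreg"
  obtains \<kappa> \<delta> where "\<kappa> > 0" "\<delta> > 0"
    "\<And>q L ys xs. dist q p < \<delta> \<Longrightarrow> L \<in> SstarF F q \<Longrightarrow> (ys, xs) \<in> L \<Longrightarrow> norm ys \<le> \<kappa> * norm xs"
proof (rule ccontr)
  assume neg: "\<not> thesis"
  \<comment> \<open>\<open>e k\<close> is both the radius tried for \<open>\<delta>\<close> and the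
    reciprocal of the factor \<open>real (Suc k)\<close> tried for \<open>\<kappa>\<close>.\<close>
  define e where "e k = inverse (real (Suc k))" for k
  have e0: "e k > 0" for k by (simp add: e_def)
  have elim: "e \<longlonglongrightarrow> 0" unfolding e_def by (rule LIMSEQ_inverse_real_of_nat)
  \<comment> \<open>The data of the counterexample at stage \<open>k\<close>. The first factor 2
    adds up two distances below \<open>e k\<close>, the second comes from
    \<open>norm z \<le> 2\<close>.\<close>
  define P where "P k q b z \<longleftrightarrow> q \<in> OF_set F \<and> dist q p < 2 * e k \<and> orthonormal_frame b
      \<and> frame_span b = adj (tangent_cone (gph F) q)
      \<and> norm (fst z) = 1 \<and> norm (snd z) \<le> e k \<and> norm (z - frame_proj b z) \<le> 2 * e k"
    for k q z and b :: "((real ^ 'n) \<times> (real ^ 'n)) ^ 'n"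
  have "\<exists>q b z. P k q b z"
    for k
  proof -
    have "\<not> (\<forall>q L ys xs. dist q p < e k \<longrightarrow> L \<in> SstarF F q \<longrightarrow> (ys, xs) \<in> L
        \<longrightarrow> norm ys \<le> real (Suc k) * norm xs)"
    proof
      assume *: "\<forall>q L ys xs. dist q p < e k \<longrightarrow> L \<in> SstarF F q \<longrightarrow> (ys, xs) \<in> L
        \<longrightarrow> norm ys \<le> real (Suc k) * norm xs"
      have thesis
      proof (rule that[of "real (Suc k)" "e k"])
        show "norm ys \<le> real (Suc k) * norm xs"
          if "dist q p < e k" "L \<in> SstarF F q" "(ys, xs) \<in> L" for q L ys xs
          using * that by blast
      qed (use e0 in auto)
      then show False using neg by contradiction
    qed
    then obtain q L ys xs where L: "dist q p < e k" "L \<in> SstarF F q" "(ys, xs) \<in> L"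
      and gt: "norm ys > real (Suc k) * norm xs"
      unfolding not_all not_imp not_le by blast
    \<comment> \<open>The violation sits in a limit subspace \<open>L\<close> at \<open>q\<close>.
      Passing to a true adjoint tangent space at a nearby \<open>r\<close> makes a diagonal sequence
      possible, at the price that \<open>z\<close> lies only approximately in it.\<close>
    obtain r where r: "r \<in> OF_set F" "dist r q < e k" "dZ L (adj (tangent_cone (gph F) r)) < e k"
      using SstarF_approx[OF L(2) e0] .
    have M: "adj (tangent_cone (gph F) r) \<in> Zn" by (intro adj_Zn tangent_cone_Zn r)
    then obtain b :: "((real ^ 'n) \<times> (real ^ 'n)) ^ 'n" where
      b: "orthonormal_frame b" "frame_span b = adj (tangent_cone (gph F) r)"
      using orthonormal_frame_exists unfolding Zn_def by blast
    have sL: "subspace L" using L(2) SstarF_Zn Zn_subspace by blast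
    have "0 \<le> real (Suc k) * norm xs" by simp
    then have ys0: "norm ys > 0" using gt by linarith
    define z where "z = (1 / norm ys) *\<^sub>R (ys, xs)"
    have z1: "norm (fst z) = 1" using ys0 by (simp add: z_def)
    have z2: "norm (snd z) \<le> e k"
      using gt ys0 by (simp add: z_def e_def field_simps)
    have "e k \<le> 1" by (simp add: e_def field_simps)
    then have zn: "norm z \<le> 2" using norm_Pair_le[of "fst z" "snd z"] z1 z2 by simp
    have "z \<in> L" unfolding z_def by (intro subspace_scale sL L)
    then have "norm (z - frame_proj b z) \<le> dZ L (frame_span b) * norm z"
      using norm_orth_proj_diff_le[OF sL subspace_frame_span, of z b]
      unfolding orth_proj_frame_span[OF b(1)] orth_proj_self[OF sL \<open>z \<in> L\<close>] by simp
    also have "\<dots> \<le> e k * 2"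
      using r(3) zn e0[of k] b dZ_nonneg[OF sL subspace_frame_span, of b]
      by (intro mult_mono) auto
    finally have z3: "norm (z - frame_proj b z) \<le> 2 * e k" by simp
    have "dist r p < 2 * e k" using L(1) r(2) dist_triangle[of r p q] by linarith
    then show ?thesis using r(1) b z1 z2 z3 unfolding P_def by blast
  qed
  then obtain q b z where P: "\<And>k. P k (q k) (b k) (z k)" by metis
  have q: "q k \<in> OF_set F" "dist (q k) p < 2 * e k"
    and b: "orthonormal_frame (b k)" "frame_span (b k) = adj (tangent_cone (gph F) (q k))"
    and z: "norm (fst (z k)) = 1" "norm (snd (z k)) \<le> e k"
      "norm (z k - frame_proj (b k) (z k)) \<le> 2 * e k" for k
    using P[of k] unfolding P_def by blast+
  have elim2: "(\<lambda>k. 2 * e k) \<longlonglongrightarrow> 0" using tendsto_mult_right_zero[OF elim] .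
  have "norm (z k) \<le> 2" for k
  proof -
    have "e k \<le> 1" by (simp add: e_def field_simps)
    then show ?thesis using norm_Pair_le[of "fst (z k)" "snd (z k)"] z(1,2)[of k] by simp
  qed
  define K where "K = {b :: ((real ^ 'n) \<times> (real ^ 'n)) ^ 'n. orthonormal_frame b}
    \<times> cball (0 :: (real ^ 'n) \<times> (real ^ 'n)) 2"
  have "seq_compact K"
    unfolding K_def
    by (intro compact_imp_seq_compact compact_Times compact_orthonormal_frames compact_cball)
  moreover have "\<forall>k. (b k, z k) \<in> K" using b \<open>\<And>k. norm (z k) \<le> 2\<close> by (auto simp: K_def)
  ultimately obtain l s where l: "l \<in> K"
    and s: "strict_mono (s :: nat \<Rightarrow> nat)" and conv: "((\<lambda>k. (b k, z k)) \<circ> s) \<longlonglongrightarrow> l"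
    by (rule seq_compactE)
  obtain c w where cw: "l = (c, w)" by (cases l)
  have c: "orthonormal_frame c" using l cw by (simp add: K_def)
  have bs: "(\<lambda>k. b (s k)) \<longlonglongrightarrow> c" and zs: "(\<lambda>k. z (s k)) \<longlonglongrightarrow> w"
    using tendsto_fst[OF conv] tendsto_snd[OF conv] cw by (simp_all add: o_def)
  have es: "(\<lambda>k. e (s k)) \<longlonglongrightarrow> 0" "(\<lambda>k. 2 * e (s k)) \<longlonglongrightarrow> 0"
    using LIMSEQ_subseq_LIMSEQ[OF elim s] LIMSEQ_subseq_LIMSEQ[OF elim2 s] by (simp_all add: o_def)
  have "(\<lambda>k. z (s k) - frame_proj (b (s k)) (z (s k))) \<longlonglongrightarrow> 0"
    by (rule Lim_null_comparison[OF _ es(2)]) (simp add: z)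
  \<comment> \<open>The limit vector is fixed by the limit projection and therefore lies exactly in
    the limit subspace.\<close>
  then have "w - frame_proj c w = 0"
    using LIMSEQ_unique tendsto_diff[OF zs tendsto_frame_proj[OF bs zs]] by blast
  then have w: "w \<in> frame_span c"
    using orth_proj_in[OF subspace_frame_span[of c], of w] by (simp add: orth_proj_frame_span[OF c])
  have "(\<lambda>k. snd (z (s k))) \<longlonglongrightarrow> 0"
    by (rule Lim_null_comparison[OF _ es(1)]) (simp add: z)
  then have w2: "snd w = 0" using LIMSEQ_unique tendsto_snd[OF zs] by blast
  have w1: "norm (fst w) = 1"
    using LIMSEQ_unique[OF tendsto_norm[OF tendsto_fst[OF zs]]] z(1) by simp
  have "frame_span c \<in> SstarF F p"
    unfolding SstarF_def
  proof (intro CollectI conjI exI[of _ "q \<circ> s"] allI)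
    show "frame_span c \<in> Zn" by (simp add: Zn_def subspace_frame_span dim_frame_span[OF c])
    show "(q \<circ> s) k \<in> OF_set F" for k using q by simp
    have "(\<lambda>k. dist (q (s k)) p) \<longlonglongrightarrow> 0"
      by (rule tendsto_sandwich[OF _ _ tendsto_const es(2)]) (simp_all add: q less_imp_le)
    then show "(q \<circ> s) \<longlonglongrightarrow> p" unfolding o_def by (rule tendsto_dist_iff[THEN iffD2])
    show "(\<lambda>k. dZ (frame_span c) (adj (tangent_cone (gph F) ((q \<circ> s) k)))) \<longlonglongrightarrow> 0"
      using dZ_frame_span_tendsto[OF b(1) c bs] by (simp add: b(2))
  qed
  then have "\<forall>ys. (ys, 0) \<in> frame_span c \<longrightarrow> ys = 0" using reg unfolding Zreg_def by blast
  then have "fst w = 0" using w w2 by (cases w) simp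
  then show False using w1 by simp
qed


section \<open>Regular subspaces and Newton directions\<close>

text \<open>Regularity says that \<open>snd\<close> has trivial kernel on \<open>L\<close>; since
  \<open>L\<close> has dimension n, its image is the whole space.\<close>

lemma Zreg_snd_onto:
  assumes "L \<in> Zreg"
  obtains y where "(y, w) \<in> L"
proof -
  have L: "subspace L" "dim L = CARD('a)" "\<And>y. (y, 0) \<in> L \<Longrightarrow> y = 0"
    using assms by (auto simp: Zreg_def Zn_def)
  have "inj_on snd L"
  proof (rule inj_onI)
    fix p q assume pq: "p \<in> L" "q \<in> L" "snd p = snd q"
    then have "(fst p - fst q, 0) \<in> L"
      using subspace_diff[OF L(1) pq(1,2)] by (simp add: minus_prod_def)
    then show "p = q" using L(3) pq(3) by (metis prod_eq_iff right_minus_eq)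
  qed
  then have "inj_on snd (span L)" using L(1) by (metis span_eq_iff)
  then have "dim (snd ` L) = CARD('a)"
    using dim_image_eq[OF linear_snd] L(2) by metis
  then have "span (snd ` L) = UNIV" using dim_eq_full[of "snd ` L"] by simp
  moreover have "span (snd ` L) = snd ` L"
    unfolding span_eq_iff by (rule linear_subspace_image[OF linear_snd L(1)])
  ultimately have "w \<in> snd ` L" by simp
  then show ?thesis using that by force
qed

text \<open>Pairing \<open>(y, 0)\<close> in \<open>adj L\<close> with some \<open>(u, y)\<close> in
  \<open>L\<close>, which exists by surjectivity, gives \<open>y \<bullet> y = 0\<close>.\<close>

lemma adj_Zreg:
  assumes "L \<in> Zreg"
  shows "adj L \<in> Zreg"
proof -
  have "y = 0" if "(y, 0) \<in> adj L" for y
  proof -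
    obtain u where "(u, y) \<in> L" using Zreg_snd_onto[OF assms] .
    then have "y \<bullet> y = 0" using that by (fastforce simp: mem_adj_iff)
    then show ?thesis by simp
  qed
  then show ?thesis using assms adj_Zn by (auto simp: Zreg_def)
qed

lemma SF_subset_Zreg:
  assumes "SstarF F p \<subseteq> Zreg"
  shows "SF F p \<subseteq> Zreg"
proof
  fix L assume L: "L \<in> SF F p"
  then have "adj (adj L) \<in> Zreg" using assms adj_SF adj_Zreg by blast
  then show "L \<in> Zreg" using L by (simp add: adj_adj Zn_subspace SF_Zn)
qed

text \<open>The components of the frame vectors of \<open>L\<close> serve as the columns of the two
  matrices.\<close>

lemma Zn_eq_rge:
  assumes "L \<in> Zn"
  obtains A B where "L = rge A B"
proof -
  obtain b :: "((real ^ 'a) \<times> (real ^ 'a)) ^ 'a" where b: "frame_span b = L"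
    using orthonormal_frame_exists assms unfolding Zn_def by blast
  have "(\<Sum>i\<in>UNIV. u $ i *\<^sub>R b $ i)
      = ((\<chi> i j. fst (b $ j) $ i) *v u, (\<chi> i j. snd (b $ j) $ i) *v u)" for u
    by (simp add: prod_eq_iff fst_sum snd_sum vec_eq_iff matrix_vector_mult_def mult.commute)
  then have "L = rge (\<chi> i j. fst (b $ j) $ i) (\<chi> i j. snd (b $ j) $ i)"
    using b unfolding frame_span_eq rge_def by auto
  then show ?thesis using that by blast
qed

lemma rge_Zreg_solvable:
  assumes "rge A B \<in> Zreg"
  shows "\<exists>p. B *v p = w"
proof -
  obtain y where "(y, w) \<in> rge A B" using Zreg_snd_onto[OF assms] .
  then show ?thesis by (auto simp: rge_def)
qed

text \<open>Regularity makes \<open>transpose A\<close> surjective; a right inverse of it transposes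
  to a left inverse of the square matrix \<open>A\<close>, which is also a right inverse.\<close>

lemma rge_transpose_Zreg_solvable:
  assumes "rge (transpose B) (transpose A) \<in> Zreg"
  shows "\<exists>d. A *v d = w"
proof -
  have "surj ((*v) (transpose A))"
    using rge_Zreg_solvable[OF assms] by (metis surjI)
  then obtain C where "transpose A ** C = mat 1"
    using matrix_right_invertible_surjective by blast
  then have "transpose C ** A = mat 1"
    by (metis matrix_transpose_mul transpose_mat transpose_transpose)
  then have "A ** transpose C = mat 1" using matrix_left_right_inverse by blast
  then show ?thesis by (metis matrix_vector_mul_assoc matrix_vector_mul_lid)
qed

text \<open>With \<open>ys\<close> and \<open>xs\<close> the images of one \<open>u\<close> under
  the transposed matrices, both sides equal \<open>u \<bullet> (A *v d)\<close>.\<close>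

lemma newton_dir_a_inner:
  assumes "newton_dir_a L y d" "(ys, xs) \<in> L"
  shows "xs \<bullet> d = - (ys \<bullet> y)"
proof -
  obtain A B where L: "L = rge (transpose B) (transpose A)" "A *v d = - (B *v y)"
    using assms(1) by (auto simp: newton_dir_a_def)
  then obtain u where "ys = transpose B *v u" "xs = transpose A *v u"
    using assms(2) by (auto simp: rge_def)
  then show ?thesis by (simp add: transpose_matrix_vector dot_lmul_matrix L)
qed

text \<open>The parameter \<open>p\<close> shows \<open>(d, - y)\<close> to be in \<open>L\<close>;
  the claim is its symplectic orthogonality to \<open>(ys, xs)\<close>. Alternative b) thus obeys
  the same relation as a), on the adjoint subspace.\<close>

lemma newton_dir_b_inner:
  assumes "newton_dir_b L y d" "(ys, xs) \<in> adj L"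
  shows "xs \<bullet> d = - (ys \<bullet> y)"
proof -
  have "(d, - y) \<in> L" using assms(1) by (auto simp: newton_dir_b_def rge_def)
  then have "d \<bullet> xs = (- y) \<bullet> ys" using assms(2) by (auto simp: mem_adj_iff)
  then show ?thesis by (simp add: inner_commute)
qed

text \<open>Test the semismoothness inequality with the element \<open>(ys, xs)\<close> of \<open>L\<close> whose second
  component is the error \<open>x + d - xb\<close> of the Newton step: its left-hand side is then the squared error.\<close>

lemma newton_error_le:
  assumes L: "L \<in> Zreg"
    and bound: "\<And>ys xs. (ys, xs) \<in> L \<Longrightarrow> norm ys \<le> \<kappa> * norm xs"
    and dir: "\<And>ys xs. (ys, xs) \<in> L \<Longrightarrow> xs \<bullet> d = - (ys \<bullet> y)"
    and semi: "\<And>ys xs. (ys, xs) \<in> L \<Longrightarrow> \<bar>xs \<bullet> (x - xb) - ys \<bullet> y\<bar> \<le> c * norm (xs, ys)"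
    and "0 \<le> c" "0 \<le> \<kappa>"
  shows "norm (x + d - xb) \<le> c * (1 + \<kappa>)"
proof -
  define w where "w = x + d - xb"
  obtain ys where ys: "(ys, w) \<in> L" using Zreg_snd_onto[OF L] .
  have "(norm w)\<^sup>2 = w \<bullet> (x - xb) + w \<bullet> d"
    by (simp add: w_def dot_square_norm[symmetric] inner_add_right inner_diff_right)
  also have "\<dots> \<le> c * norm (w, ys)" using semi[OF ys] dir[OF ys] by simp
  also have "\<dots> \<le> c * (norm w + \<kappa> * norm w)"
    using norm_Pair_le[of w ys] bound[OF ys] \<open>0 \<le> c\<close> by (intro mult_left_mono) auto
  finally have "norm w * norm w \<le> (c * (1 + \<kappa>)) * norm w"
    by (simp add: power2_eq_square algebra_simps)
  \<comment> \<open>One factor \<open>norm w\<close> is cancelled; for \<open>w = 0\<close> the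
    bound is just nonnegativity of its right-hand side.\<close>
  then show ?thesis
    using \<open>0 \<le> c\<close> \<open>0 \<le> \<kappa>\<close> unfolding w_def[symmetric]
    by (cases "w = 0") (auto simp: mult_le_cancel_right)
qed


section \<open>Convergence of the Newton-type method\<close>

text \<open>The approximation step always admits the choice \<open>(xh, yh) = (xb, 0)\<close>.\<close>

lemma newton_admissible_executable:
  assumes "(xb, 0) \<in> gph F" "\<eta> > 0"
    and ok: "\<And>p. p \<in> gph F \<Longrightarrow> norm (p - (xb, 0)) \<le> \<eta> * norm (x - xb)
      \<Longrightarrow> SstarF F p \<noteq> {} \<and> SstarF F p \<subseteq> Zreg"
  shows "choices_admissible F \<eta> xb x" "newton_executable F \<eta> xb x"
proof -
  have ok': "SstarF F (xh, yh) \<noteq> {} \<and> SstarF F (xh, yh) \<subseteq> Zreg"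
    if "approx_bound F \<eta> xb x xh yh" for xh yh
    using that ok unfolding approx_bound_def by blast
  then show "choices_admissible F \<eta> xb x"
    unfolding choices_admissible_def approx_step_def using SF_subset_Zreg by blast
  \<comment> \<open>The adjoint of a regular member of \<open>SstarF\<close> is a regular member of
    \<open>SF\<close>.\<close>
  have SF_ne: "SF F (xh, yh) \<inter> Zreg \<noteq> {}" if "approx_step F \<eta> xb x xh yh" for xh yh
    using that adj_SstarF adj_Zreg unfolding approx_step_def by blast
  have "approx_bound F \<eta> xb x xb 0" using assms by (simp add: approx_bound_def)
  then have step: "approx_step F \<eta> xb x xb 0" unfolding approx_step_def using ok' by blast
  show "newton_executable F \<eta> xb x"
    unfolding newton_executable_def
  proof (intro conjI allI impI ballI)
    show "\<exists>xh yh. approx_step F \<eta> xb x xh yh" using step by blast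
  next
    fix xh yh L
    assume "approx_step F \<eta> xb x xh yh" and L: "L \<in> SstarF F (xh, yh) \<inter> Zreg"
    obtain A B where "L = rge A B" using Zn_eq_rge L SstarF_Zn by blast
    then show "\<exists>A B. L = rge (transpose B) (transpose A)" by (metis transpose_transpose)
    show "\<exists>d. A *v d = - (B *v yh)" if "L = rge (transpose B) (transpose A)" for A B
      using L that rge_transpose_Zreg_solvable by blast
  next
    fix xh yh L
    assume "approx_step F \<eta> xb x xh yh" and L: "L \<in> SF F (xh, yh) \<inter> Zreg"
    show "\<exists>A B. L = rge A B" using Zn_eq_rge L SF_Zn by blast
    show "\<exists>p. B *v p = - yh" if "L = rge A B" for A B
      using L that rge_Zreg_solvable by blast
  qed (use SF_ne in \<open>auto simp: approx_step_def\<close>)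
qed

text \<open>The contraction factor \<open>\<epsilon>\<close> is arbitrary while
  \<open>\<kappa>\<close> stays fixed: only the radius \<open>\<rho>\<close> depends on
  \<open>\<epsilon>\<close>, which is what superlinear convergence requires.\<close>

lemma newton_step_contracts:
  assumes semi: "SCD_semismooth_star F xb 0" and "\<eta> > 0" "\<kappa> > 0" "\<delta> > 0"
    and reg: "\<And>p. p \<in> gph F \<Longrightarrow> norm (p - (xb, 0)) < \<delta> \<Longrightarrow> SstarF F p \<subseteq> Zreg"
    and bound: "\<And>p L ys xs. p \<in> gph F \<Longrightarrow> norm (p - (xb, 0)) < \<delta> \<Longrightarrow> L \<in> SstarF F p
      \<Longrightarrow> (ys, xs) \<in> L \<Longrightarrow> norm ys \<le> \<kappa> * norm xs"
    and "\<epsilon> > 0"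
  obtains \<rho> where "\<rho> > 0"
    "\<And>x x'. norm (x - xb) < \<rho> \<Longrightarrow> newton_step_any F \<eta> xb x x' \<Longrightarrow> norm (x' - xb) \<le> \<epsilon> * norm (x - xb)"
proof -
  \<comment> \<open>Chosen so that the factor \<open>e * (1 + \<kappa>)\<close> of the Newton step
    times the factor \<open>\<eta>\<close> of the approximation step is
    \<open>\<epsilon>\<close>.\<close>
  define e where "e = \<epsilon> / (\<eta> * (1 + \<kappa>))"
  have e: "e > 0" using assms by (simp add: e_def add_pos_pos)
  obtain \<delta>' where "\<delta>' > 0" and \<delta>': "\<And>x y L ys xs. (x, y) \<in> gph F \<Longrightarrow> norm ((x, y) - (xb, 0)) \<le> \<delta>'
      \<Longrightarrow> L \<in> SstarF F (x, y) \<Longrightarrow> (ys, xs) \<in> L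
      \<Longrightarrow> \<bar>xs \<bullet> (x - xb) - ys \<bullet> (y - 0)\<bar> \<le> e * norm ((x, y) - (xb, 0)) * norm (xs, ys)"
    using semi e unfolding SCD_semismooth_star_def by meson
  show ?thesis
  proof
    \<comment> \<open>Division by \<open>\<eta>\<close> places the approximating point, rather than
      \<open>x\<close> itself, within \<open>\<delta>\<close> and \<open>\<delta>'\<close> of
      \<open>(xb, 0)\<close>.\<close>
    show "min \<delta> \<delta>' / \<eta> > 0" using assms \<open>\<delta>' > 0\<close> by simp
    fix x x'
    assume x: "norm (x - xb) < min \<delta> \<delta>' / \<eta>" and "newton_step_any F \<eta> xb x x'"
    then obtain xh yh L d where app: "approx_bound F \<eta> xb x xh yh" and x': "x' = xh + d"
      and dir: "L \<in> SstarF F (xh, yh) \<and> newton_dir_a L yh d \<or> L \<in> SF F (xh, yh) \<and> newton_dir_b L yh d"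
      unfolding newton_step_any_def by blast
    define r where "r = norm ((xh, yh) - (xb, 0))"
    have p: "(xh, yh) \<in> gph F" and r: "r \<le> \<eta> * norm (x - xb)"
      using app by (auto simp: approx_bound_def r_def)
    have "\<eta> * norm (x - xb) < min \<delta> \<delta>'" using x \<open>\<eta> > 0\<close> by (simp add: field_simps)
    then have r': "norm ((xh, yh) - (xb, 0)) < \<delta>" "norm ((xh, yh) - (xb, 0)) \<le> \<delta>'"
      using r unfolding r_def by linarith+
    \<comment> \<open>\<open>M\<close> is \<open>L\<close> in alternative a) and
      \<open>adj L\<close> in alternative b).\<close>
    obtain M where M: "M \<in> SstarF F (xh, yh)"
      and Md: "\<And>ys xs. (ys, xs) \<in> M \<Longrightarrow> xs \<bullet> d = - (ys \<bullet> yh)"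
      using dir newton_dir_a_inner newton_dir_b_inner adj_SF by metis
    have "norm (xh + d - xb) \<le> (e * r) * (1 + \<kappa>)"
    proof (rule newton_error_le[of M \<kappa> d yh xh xb])
      show "M \<in> Zreg" using reg[OF p r'(1)] M by blast
      show "\<bar>xs \<bullet> (xh - xb) - ys \<bullet> yh\<bar> \<le> e * r * norm (xs, ys)" if "(ys, xs) \<in> M" for ys xs
        using \<delta>'[OF p r'(2) M that] by (simp add: r_def)
    qed (use bound[OF p r'(1) M] Md e \<open>\<kappa> > 0\<close> in \<open>auto simp: r_def\<close>)
    also have "\<dots> \<le> (e * (\<eta> * norm (x - xb))) * (1 + \<kappa>)"
      using r e \<open>\<kappa> > 0\<close> by (intro mult_right_mono mult_left_mono) auto
    also have "\<dots> = \<epsilon> * norm (x - xb)"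
    proof -
      have "\<eta> * (1 + \<kappa>) \<noteq> 0" using \<open>\<eta> > 0\<close> \<open>\<kappa> > 0\<close> by auto
      then have "e * (\<eta> * (1 + \<kappa>)) = \<epsilon>" by (simp add: e_def)
      then show ?thesis by (metis mult.assoc mult.commute)
    qed
    finally show "norm (x' - xb) \<le> \<epsilon> * norm (x - xb)" by (simp add: x')
  qed
qed

text \<open>Halving keeps the iterates in the ball and gives geometric convergence; hence they
  eventually enter each radius \<open>r\<close> supplied by \<open>contr\<close>, where the factor
  \<open>\<epsilon>\<close> applies.\<close>

lemma superlinear_convergenceI:
  fixes x :: "nat \<Rightarrow> 'a::real_normed_vector"
  assumes x0: "norm (x 0 - l) < \<rho>"
    and half: "\<And>k. norm (x k - l) < \<rho> \<Longrightarrow> norm (x (Suc k) - l) \<le> 1/2 * norm (x k - l)"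
    and contr: "\<And>\<epsilon>. \<epsilon> > 0 \<Longrightarrow> \<exists>r>0. \<forall>k. norm (x k - l) < r \<longrightarrow> norm (x (Suc k) - l) \<le> \<epsilon> * norm (x k - l)"
  shows "superlinear_convergence x l"
proof -
  have geo: "norm (x k - l) \<le> (1/2) ^ k * norm (x 0 - l) \<and> norm (x k - l) < \<rho>" for k
  proof (induction k)
    case 0
    then show ?case using x0 by simp
  next
    case (Suc k)
    then have le: "norm (x (Suc k) - l) \<le> 1/2 * norm (x k - l)" using half by blast
    then have "norm (x (Suc k) - l) \<le> (1/2) ^ Suc k * norm (x 0 - l)" using Suc by simp
    moreover have "norm (x (Suc k) - l) < \<rho>"
      using le Suc norm_ge_zero[of "x (Suc k) - l"] by linarith
    ultimately show ?case ..
  qed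
  have "(\<lambda>k. (1/2) ^ k * norm (x 0 - l)) \<longlonglongrightarrow> 0"
    by (intro tendsto_mult_left_zero LIMSEQ_power_zero) simp
  then have "(\<lambda>k. x k - l) \<longlonglongrightarrow> 0"
    by (rule Lim_null_comparison[rotated]) (use geo in auto)
  then have lim: "x \<longlonglongrightarrow> l" by (rule LIM_zero_cancel)
  have "(\<lambda>k. norm (x (Suc k) - l)) \<in> o(\<lambda>k. norm (x k - l))"
  proof (rule landau_o.smallI)
    fix c :: real assume "c > 0"
    then obtain r where "r > 0" and r: "\<And>k. norm (x k - l) < r \<Longrightarrow> norm (x (Suc k) - l) \<le> c * norm (x k - l)"
      using contr by blast
    have "\<forall>\<^sub>F k in sequentially. norm (x k - l) < r"
      using tendstoD[OF lim \<open>r > 0\<close>] by (simp add: dist_norm)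
    then show "\<forall>\<^sub>F k in sequentially. norm (norm (x (Suc k) - l)) \<le> c * norm (norm (x k - l))"
      by eventually_elim (simp add: r)
  qed
  then show ?thesis using lim by (simp add: superlinear_convergence_def)
qed

theorem theorem4p4:
  fixes F :: "real ^ 'n \<Rightarrow> (real ^ 'n) set" and xb :: "real ^ 'n"
  assumes "(xb, 0) \<in> gph F"
    and "SCD_semismooth_star F xb 0"
    and "SCD_regular_around F xb 0"
  shows "\<forall>\<eta>>0. \<exists>U. open U \<and> xb \<in> U \<and>
    (\<forall>x0 \<in> U. newton_well_defined F \<eta> xb x0 \<and>
      (\<forall>x. x 0 = x0 \<and> newton_run F \<eta> xb x \<longrightarrow>
        (\<exists>k. stops_at F x k) \<or>
        ((\<forall>k. 0 \<notin> F (x k)) \<and> superlinear_convergence x xb)))"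
proof (intro allI impI)
  fix \<eta> :: real assume \<eta>: "\<eta> > 0"
  obtain \<kappa> \<delta>1 where \<kappa>: "\<kappa> > 0" and "\<delta>1 > 0"
    and bound: "\<And>q L ys xs. dist q (xb, 0) < \<delta>1 \<Longrightarrow> L \<in> SstarF F q \<Longrightarrow> (ys, xs) \<in> L
      \<Longrightarrow> norm ys \<le> \<kappa> * norm xs"
    using SstarF_norm_bound assms(3) unfolding SCD_regular_around_def by metis
  obtain W where "open W" "(xb, 0) \<in> W" and W: "\<And>q. q \<in> gph F \<Longrightarrow> q \<in> W \<Longrightarrow> SstarF F q \<noteq> {}"
    using assms(3) unfolding SCD_regular_around_def SCD_around_def SCD_at_def by blast
  then obtain \<delta>2 where "\<delta>2 > 0" and \<delta>2: "ball (xb, 0) \<delta>2 \<subseteq> W" by (metis openE)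
  define \<delta> where "\<delta> = min \<delta>1 \<delta>2"
  have \<delta>: "\<delta> > 0" using \<open>\<delta>1 > 0\<close> \<open>\<delta>2 > 0\<close> by (simp add: \<delta>_def)
  have ne: "SstarF F p \<noteq> {}" if "p \<in> gph F" "norm (p - (xb, 0)) < \<delta>" for p
    using that \<delta>2 W[of p] by (auto simp: \<delta>_def dist_norm norm_minus_commute)
  have bd: "norm ys \<le> \<kappa> * norm xs"
    if "p \<in> gph F" "norm (p - (xb, 0)) < \<delta>" "L \<in> SstarF F p" "(ys, xs) \<in> L" for p L ys xs
    using bound[of p L ys xs] that by (simp add: \<delta>_def dist_norm)
  \<comment> \<open>The case \<open>xs = 0\<close> of the uniform bound: it forces
    \<open>norm ys \<le> 0\<close>.\<close>
  have rg: "SstarF F p \<subseteq> Zreg" if "p \<in> gph F" "norm (p - (xb, 0)) < \<delta>" for p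
    using bd[OF that] SstarF_Zn unfolding Zreg_def by fastforce
  have contr: "\<exists>\<rho>>0. \<forall>x x'. norm (x - xb) < \<rho> \<longrightarrow> newton_step_any F \<eta> xb x x'
      \<longrightarrow> norm (x' - xb) \<le> \<epsilon> * norm (x - xb)" if "\<epsilon> > 0" for \<epsilon>
  proof (rule newton_step_contracts[OF assms(2) \<eta> \<kappa> \<delta> _ _ that])
    show "SstarF F p \<subseteq> Zreg" if "p \<in> gph F" "norm (p - (xb, 0)) < \<delta>" for p
      using rg that .
    show "norm ys \<le> \<kappa> * norm xs"
      if "p \<in> gph F" "norm (p - (xb, 0)) < \<delta>" "L \<in> SstarF F p" "(ys, xs) \<in> L" for p L ys xs
      using bd that .
  qed blast
  obtain \<rho>0 where "\<rho>0 > 0" and \<rho>0: "\<And>x x'. norm (x - xb) < \<rho>0 \<Longrightarrow> newton_step_any F \<eta> xb x x'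
      \<Longrightarrow> norm (x' - xb) \<le> 1/2 * norm (x - xb)"
    using contr[of "1/2"] by auto
  \<comment> \<open>Within \<open>\<rho>0\<close> each step halves the error; within
    \<open>\<delta> / \<eta>\<close> every permitted approximation lies in the region where
    \<open>SstarF\<close> is nonempty and regular.\<close>
  define \<rho> where "\<rho> = min \<rho>0 (\<delta> / \<eta>)"
  have \<rho>: "\<rho> > 0" using \<open>\<rho>0 > 0\<close> \<delta> \<eta> by (simp add: \<rho>_def)
  have good: "choices_admissible F \<eta> xb x" "newton_executable F \<eta> xb x" if "norm (x - xb) < \<rho>" for x
  proof -
    have "\<eta> * norm (x - xb) < \<delta>" using that \<eta> by (simp add: \<rho>_def field_simps)
    then have ok: "SstarF F p \<noteq> {} \<and> SstarF F p \<subseteq> Zreg"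
      if "p \<in> gph F" "norm (p - (xb, 0)) \<le> \<eta> * norm (x - xb)" for p
      using that ne[of p] rg[of p] by auto
    show "choices_admissible F \<eta> xb x" "newton_executable F \<eta> xb x"
      using newton_admissible_executable[OF assms(1) \<eta> ok] by blast+
  qed
  have half: "norm (x' - xb) \<le> 1/2 * norm (x - xb)"
    if "norm (x - xb) < \<rho>" "newton_step_any F \<eta> xb x x'" for x x'
    using \<rho>0 that by (simp add: \<rho>_def)
  have well: "newton_well_defined F \<eta> xb x0" if "norm (x0 - xb) < \<rho>" for x0
  proof -
    \<comment> \<open>The ball is invariant under every permitted step, so no reachable iterate
      leaves the region where a pass can be carried out.\<close>
    have "norm (x - xb) < \<rho>" if "x \<in> newton_iterates F \<eta> xb x0" for x
      using that
    proof induction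
      case start
      then show ?case by fact
    next
      case (step x x')
      then show ?case using half[of x x'] norm_ge_zero[of "x - xb"] by linarith
    qed
    then show ?thesis unfolding newton_well_defined_def using good by blast
  qed
  have run: "superlinear_convergence x xb"
    if x0: "norm (x 0 - xb) < \<rho>" and x: "newton_run F \<eta> xb x" and nz: "\<forall>k. 0 \<notin> F (x k)" for x
  proof -
    have st: "newton_step_any F \<eta> xb (x k) (x (Suc k))" for k
      using x nz unfolding newton_run_def by blast
    show ?thesis
      by (rule superlinear_convergenceI[of x xb \<rho>, OF x0]) (use half st contr in blast)+
  qed
  \<comment> \<open>If the stopping test ever succeeds, the least such index is where the run
    stops.\<close>
  have stop: "(\<exists>k. stops_at F x k) \<or> (\<forall>k. 0 \<notin> F (x k))" for x
    unfolding stops_at_def using exists_least_iff[of "\<lambda>k. 0 \<in> F (x k)"] by blast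
  show "\<exists>U. open U \<and> xb \<in> U \<and> (\<forall>x0 \<in> U. newton_well_defined F \<eta> xb x0 \<and>
      (\<forall>x. x 0 = x0 \<and> newton_run F \<eta> xb x \<longrightarrow>
        (\<exists>k. stops_at F x k) \<or> ((\<forall>k. 0 \<notin> F (x k)) \<and> superlinear_convergence x xb)))"
  proof (intro exI[of _ "ball xb \<rho>"] conjI ballI allI impI)
    fix x0 assume "x0 \<in> ball xb \<rho>"
    then have x0: "norm (x0 - xb) < \<rho>" by (simp add: dist_norm norm_minus_commute)
    show "newton_well_defined F \<eta> xb x0" using well[OF x0] .
    show "(\<exists>k. stops_at F x k) \<or> ((\<forall>k. 0 \<notin> F (x k)) \<and> superlinear_convergence x xb)"
      if "x 0 = x0 \<and> newton_run F \<eta> xb x" for x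
      using stop[of x] run[of x] that x0 by blast
  qed (use \<rho> in auto)
qed

end
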